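(* For every integer $k \geq 1$ and every vertex $v$ of the Andrásfai graph $\operatorname{And}(k)$, both $\operatorname{And}(k)$ and $\operatorname{And}(k)-v$ are 1-unique.
   Context: Graphs are finite and simple. A labeling of a graph $G$ assigns a positive integer to each vertex. A labeling is feasible if every path between two distinct vertices with the same label contains a vertex having a higher label. The tree-depth $\operatorname{td}(G)$ is the smallest $m$ for which $G$ has a feasible labeling with labels from $\{1,\dots,m\}$. A graph $G$ is 1-unique if for every vertex $w$ of $G$ there is a feasible labeling of $G$ with labels from $\{1,\dots,\operatorname{td}(G)\}$ in which $w$ is the unique vertex receiving the label 1. For a positive integer $k$, the Andrásfai graph $\operatorname{And}(k)$ has vertex set $\{0,1,\dots,3k-2\}$, and vertices $i>j$ are adjacent if and only if $i-j\equiv 1 \pmod 3$. $\operatorname{And}(k)-v$ is the graph obtained by deleting the vertex $v$; since $\operatorname{And}(k)$ is vertex-transitive, it is independent of $v$ up to isomorphism. *)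

theory Defs
  imports "Graph_Theory.Graph_Theory"
begin

text \<open>
  A finite simple graph is a symmetric digraph without loops and parallel arcs (locale
  \<^locale>\<open>graph\<close>). Its paths are the predicate \<^const>\<open>vpath\<close>: nonempty duplicate-free lists of
  vertices in which consecutive vertices are adjacent.
\<close>

text \<open>
  Only the values of a labeling on the vertices of the graph matter. The endpoints of a path
  belong to the path, but as they carry the common label they never witness the existential.
\<close>

definition feasible_labeling :: "('a, 'b) pre_digraph \<Rightarrow> ('a \<Rightarrow> nat) \<Rightarrow> bool" where
  "feasible_labeling G c \<longleftrightarrow>
     (\<forall>u \<in> verts G. 0 < c u) \<and>
     (\<forall>p. vpath p G \<and> hd p \<noteq> last p \<and> c (hd p) = c (last p)
        \<longrightarrow> (\<exists>x \<in> set p. c (hd p) < c x))"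

definition tree_depth :: "('a, 'b) pre_digraph \<Rightarrow> nat" where
  "tree_depth G = (LEAST m. \<exists>c. feasible_labeling G c \<and> c ` verts G \<subseteq> {1..m})"

definition one_unique :: "('a, 'b) pre_digraph \<Rightarrow> bool" where
  "one_unique G \<longleftrightarrow>
     (\<forall>w \<in> verts G. \<exists>c. feasible_labeling G c \<and> c ` verts G \<subseteq> {1..tree_depth G} \<and>
        {u \<in> verts G. c u = 1} = {w})"

text \<open>Meant for \<open>k \<ge> 1\<close>, where the subtraction \<open>3 * k - 2\<close> is not truncated.\<close>

definition andrasfai :: "nat \<Rightarrow> (nat, nat \<times> nat) pre_digraph" where
  "andrasfai k = with_proj
     \<lparr> pverts = {0..3 * k - 2},
       parcs = {(i, j). i \<in> {0..3 * k - 2} \<and> j \<in> {0..3 * k - 2} \<and>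
                  (j < i \<and> (i - j) mod 3 = 1 \<or> i < j \<and> (j - i) mod 3 = 1)} \<rparr>"

lemma graph_andrasfai: "graph (andrasfai k)"
proof -
  let ?V = "{0..3 * k - 2}"
  let ?P = "\<lparr> pverts = ?V,
       parcs = {(i, j). i \<in> ?V \<and> j \<in> ?V \<and>
                  (j < i \<and> (i - j) mod 3 = 1 \<or> i < j \<and> (j - i) mod 3 = 1)} \<rparr>"
  have fin: "finite (parcs ?P)"
    by (rule finite_subset[of _ "?V \<times> ?V"]) auto
  have "pair_graph ?P"
  proof
    show "symmetric (with_proj ?P)"
      by (auto simp: symmetric_def intro!: symI)
  qed (use fin in auto)
  then show ?thesis
    unfolding andrasfai_def by (rule pair_graph.pair_graphD_graph)
qed

lemma (in graph) graph_del_vert: "graph (del_vert v)"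
proof -
  interpret H: fin_digraph "del_vert v" by (rule fin_digraph_del_vert)
  show ?thesis
  proof
    show "symmetric (del_vert v)"
      using sym_arcs
      by (fastforce simp: symmetric_def sym_def arcs_ends_conv del_vert_simps)
  qed (auto simp: del_vert_simps ends_del_vert no_loops intro: no_multi_arcs)
qed

text \<open>The minimum defining the tree-depth of a finite graph is taken over a nonempty set.\<close>

lemma (in fin_digraph) tree_depth_attained:
  "\<exists>c. feasible_labeling G c \<and> c ` verts G \<subseteq> {1..tree_depth G}"
proof -
  obtain f :: "'a \<Rightarrow> nat" and n where f: "f ` verts G = {i. i < n}" "inj_on f (verts G)"
    using finite_imp_inj_to_nat_seg[OF finite_verts] by blast
  have "hd p = last p" if "vpath p G" "f (hd p) = f (last p)" for p
    using that f(2) by (auto simp: vpath_def vwalk_def inj_on_def subset_iff)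
  then have "feasible_labeling G (\<lambda>u. Suc (f u))"
    by (auto simp: feasible_labeling_def)
  moreover have "(\<lambda>u. Suc (f u)) ` verts G \<subseteq> {1..n}"
    using f(1) by (force simp: Suc_le_eq)
  ultimately have "\<exists>c. feasible_labeling G c \<and> c ` verts G \<subseteq> {1..n}"
    by blast
  then show ?thesis
    unfolding tree_depth_def by (rule LeastI)
qed

end

theory Submission
  imports Defs
begin

text \<open>
  Since \<open>3 * k = 1\<close> modulo \<open>n = 3 * k - 1\<close>, multiplication by \<open>k\<close> turns the Andrasfai graph into
  \<open>n\<close> points on a circle, adjacent when their difference modulo \<open>n\<close> lies between \<open>k\<close> and
  \<open>2 * k - 1\<close>. Its tree-depth is at least \<open>2 * k\<close>: the vertices all of whose neighbours have a
  larger label are independent, so at most \<open>k\<close>. If the other labels are distinct, this suffices.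
  Otherwise, at the largest repeated label \<open>t\<close> among them, the vertices of label at most \<open>t\<close> contain
  two disjoint edges lying in different components. Two such edges dominate the graph, hence the
  labels above \<open>t\<close> are distinct. The component of the first edge is complete bipartite with parts
  \<open>A\<close> and \<open>B\<close>, whose neighbourhoods are disjoint and have at least \<open>|A| + k - 1\<close> and \<open>|B| + k - 1\<close>
  vertices; so at least \<open>2 * k - 2\<close> vertices have a label above \<open>t \<ge> 2\<close>.

  Conversely, give \<open>w\<close> the label 1, give 2 to the neighbourhood of a vertex that has at most
  one common neighbour with \<open>w\<close>, and distinct larger labels to the rest. There are two choices of this
  neighbourhood, and they are disjoint when \<open>k \<ge> 2\<close>, so one of them survives the deletion of a
  vertex.
\<close>

section \<open>Feasible labelings\<close>

text \<open>In a symmetric graph, vertices of label at most \<open>t\<close> are related by the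
  reflexive-transitive closure iff they share a component of the subgraph induced by such
  vertices.\<close>

definition low_arcs :: "('a, 'b) pre_digraph \<Rightarrow> ('a \<Rightarrow> nat) \<Rightarrow> nat \<Rightarrow> 'a rel" where
  "low_arcs G c t = {(u, v) \<in> arcs_ends G. c u \<le> t \<and> c v \<le> t}"

text \<open>A walk through labels at most \<open>c u\<close> shortens to a path on some of its
  vertices, and such a path has no higher label to offer. Feasibility is used through this component
  form below.\<close>

lemma feasible_labeling_connected_eq:
  assumes "feasible_labeling G c" "u \<in> verts G" "(u, v) \<in> (low_arcs G c (c u))\<^sup>*" "c v = c u"
    and wf: "wf_digraph G"
  shows "u = v"
proof (rule ccontr)
  assume "u \<noteq> v"
  define t where "t = c u"
  from assms(3) have "(u, v) \<in> (low_arcs G c t)\<^sup>*" "c u \<le> t" "u \<in> verts G"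
    using assms(2) by (auto simp: t_def)
  then have "\<exists>p. vwalk p G \<and> hd p = u \<and> last p = v \<and> (\<forall>x \<in> set p. c x \<le> t)"
  proof (induction rule: converse_rtrancl_induct)
    case base
    then show ?case
      by (intro exI[of _ "[v]"]) auto
  next
    case (step y z)
    have yz: "(y, z) \<in> arcs_ends G" "c z \<le> t" "z \<in> verts G"
      using step.hyps(1) wf_digraph.adj_in_verts(2)[OF wf] by (auto simp: low_arcs_def)
    then obtain p where p: "vwalk p G" "hd p = z" "last p = v" "\<forall>x \<in> set p. c x \<le> t"
      using step.IH by blast
    then have "p \<noteq> []" by auto
    then show ?case
      using p yz step.prems by (intro exI[of _ "y # p"]) (auto intro: vwalk_consI)
  qed
  then obtain p where p: "vwalk p G" "hd p = u" "last p = v" "\<forall>x \<in> set p. c x \<le> t"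
    by blast
  define q where "q = vwalk_to_vpath p"
  have "vpath q G" "hd q = u" "last q = v" "\<forall>x \<in> set q. c x \<le> t"
    using p unfolding q_def
    by (auto simp: vwalk_to_vpath_hd vwalk_to_vpath_last
        intro: vwalk_to_vpath_vpath dest: vwalk_to_vpath_subset)
  then show False
    using assms(1,4) \<open>u \<noteq> v\<close> unfolding feasible_labeling_def t_def by (metis not_less)
qed

lemma feasible_labeling_adj_neq:
  assumes "feasible_labeling G c" "wf_digraph G" "u \<rightarrow>\<^bsub>G\<^esub> v" "u \<noteq> v"
  shows "c u \<noteq> c v"
proof
  assume "c u = c v"
  then have "(u, v) \<in> (low_arcs G c (c u))\<^sup>*"
    using assms(3) by (auto simp: low_arcs_def)
  then show False
    using feasible_labeling_connected_eq[OF assms(1)] assms \<open>c u = c v\<close>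
    by (metis wf_digraph.adj_in_verts(1))
qed

text \<open>Only vertices of \<open>S\<close> share a label, namely 2. A path between two of them
  without a higher label stays in \<open>S\<close> and \<open>w\<close>; since \<open>S\<close> is
  independent it must pass through \<open>w\<close> at its second vertex, where \<open>nbr\<close>
  identifies the two neighbours of \<open>w\<close>.\<close>

lemma (in graph) feasible_labeling_unique_1:
  assumes S: "S \<subseteq> verts G" and w: "w \<in> verts G" "w \<notin> S"
    and indep: "\<And>u v. u \<in> S \<Longrightarrow> v \<in> S \<Longrightarrow> \<not> u \<rightarrow>\<^bsub>G\<^esub> v"
    and nbr: "\<And>u v. u \<in> S \<Longrightarrow> v \<in> S \<Longrightarrow> u \<rightarrow>\<^bsub>G\<^esub> w \<Longrightarrow> w \<rightarrow>\<^bsub>G\<^esub> v \<Longrightarrow> u = v"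
    and m: "card (verts G) - card S < m" "2 \<le> m"
  shows "\<exists>c. feasible_labeling G c \<and> c ` verts G \<subseteq> {1..m} \<and> {u \<in> verts G. c u = 1} = {w}"
proof -
  define R where "R = verts G - S - {w}"
  have fin: "finite R" "finite S"
    using S by (auto simp: R_def intro: finite_subset)
  have cR: "card R = card (verts G) - card S - 1"
    unfolding R_def using S w fin by (simp add: card_Diff_subset)
  obtain f where f: "bij_betw f R {0..<card R}"
    using ex_bij_betw_finite_nat[OF fin(1)] by blast
  \<comment> \<open>The values of \<open>f\<close> start at 0, so the largest label on
    \<open>R\<close> is \<open>2 + card R\<close>, that is
    \<open>card (verts G) - card S + 1\<close>.\<close>
  define c where "c u = (if u = w then 1 else if u \<in> S then 2 else 3 + f u)" for u
  have cpos: "0 < c u" for u by (auto simp: c_def)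
  have cle: "c u \<le> m" if "u \<in> verts G" for u
  proof (cases "u \<in> R")
    case True
    then have "f u < card R" using f by (auto simp: bij_betw_def)
    then show ?thesis
      using True m cR by (auto simp: c_def R_def)
  next
    case False
    then show ?thesis using m that by (auto simp: c_def R_def)
  qed
  have both_S: "u \<in> S \<and> v \<in> S" if "u \<in> verts G" "v \<in> verts G" "c u = c v" "u \<noteq> v" for u v
  proof (rule ccontr)
    assume "\<not> (u \<in> S \<and> v \<in> S)"
    then have "u \<in> R" "v \<in> R" "f u = f v"
      using that by (auto simp: c_def R_def split: if_splits)
    then show False
      using f \<open>u \<noteq> v\<close> by (auto simp: bij_betw_def inj_on_def)
  qed
  have "\<exists>x \<in> set p. c (hd p) < c x"
    if p: "vpath p G" "hd p \<noteq> last p" "c (hd p) = c (last p)" for p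
  proof (rule ccontr)
    assume neg: "\<not> (\<exists>x \<in> set p. c (hd p) < c x)"
    have "p \<noteq> []" "set p \<subseteq> verts G" "distinct p" and arcs: "set (vwalk_arcs p) \<subseteq> arcs_ends G"
      using p(1) by (auto simp: vpath_def vwalk_def)
    then have ends: "hd p \<in> S" "last p \<in> S"
      using both_S[of "hd p" "last p"] p(2,3) by (simp_all add: subset_iff)
    then have "c (hd p) = 2" using w by (auto simp: c_def)
    then have "c x \<le> 2" if "x \<in> set p" for x
      using neg that by (metis not_less)
    then have sub: "set p \<subseteq> insert w S"
      by (force simp: c_def split: if_splits)
    obtain a b q where pab: "p = a # b # q"
      using \<open>p \<noteq> []\<close> p(2) by (metis last.simps list.exhaust_sel list.sel(1))
    have "a \<rightarrow>\<^bsub>G\<^esub> b" using arcs pab by auto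
    then have "b = w"
      using indep[of a b] ends sub pab by auto
    \<comment> \<open>The path cannot stop at \<open>w\<close>, because its last vertex lies in
      \<open>S\<close>.\<close>
    then obtain d r where q: "q = d # r"
      using ends w pab by (cases q) auto
    have "b \<rightarrow>\<^bsub>G\<^esub> d" using arcs pab q by auto
    moreover have "d \<in> S" using sub pab q \<open>b = w\<close> \<open>distinct p\<close> by auto
    ultimately have "a = d"
      using nbr[of a d] \<open>a \<rightarrow>\<^bsub>G\<^esub> b\<close> \<open>b = w\<close> ends pab by auto
    then show False using \<open>distinct p\<close> pab q by auto
  qed
  then have "feasible_labeling G c"
    using cpos by (auto simp: feasible_labeling_def)
  moreover have "c ` verts G \<subseteq> {1..m}"
    using cle cpos by (auto simp: Suc_le_eq)
  moreover have "{u \<in> verts G. c u = 1} = {w}"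
    using w by (auto simp: c_def)
  ultimately show ?thesis by blast
qed

text \<open>The new label exceeds all others, so it serves every path through \<open>v\<close>; all
  other paths already live in the smaller graph. Hence deleting a vertex lowers a bound on the
  number of labels by at most one.\<close>

lemma feasible_labeling_del_vert:
  assumes c: "feasible_labeling (pre_digraph.del_vert G v) c"
    and m: "c ` verts (pre_digraph.del_vert G v) \<subseteq> {1..m}"
  shows "feasible_labeling G (c(v := Suc m))"
  unfolding feasible_labeling_def
proof (intro conjI ballI allI impI)
  let ?H = "pre_digraph.del_vert G v"
  let ?c = "c(v := Suc m)"
  have V: "verts ?H = verts G - {v}" by (simp add: pre_digraph.verts_del_vert)
  show "0 < ?c u" if "u \<in> verts G" for u
    using c that V by (auto simp: feasible_labeling_def)
  fix p assume p: "vpath p G \<and> hd p \<noteq> last p \<and> ?c (hd p) = ?c (last p)"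
  then have pv: "p \<noteq> []" "set p \<subseteq> verts G" "distinct p" "set (vwalk_arcs p) \<subseteq> arcs_ends G"
    by (auto simp: vpath_def vwalk_def)
  have small: "c u \<le> m" if "u \<in> verts G" "u \<noteq> v" for u
    using m V that by (auto simp: image_subset_iff)
  have "hd p \<in> verts G" "last p \<in> verts G" using pv by (auto simp: subset_iff)
  then have ends: "hd p \<noteq> v" "last p \<noteq> v"
    using p small[of "hd p"] small[of "last p"] by (auto split: if_splits)
  show "\<exists>x \<in> set p. ?c (hd p) < ?c x"
  proof (cases "v \<in> set p")
    case True
    then show ?thesis
      using ends small[OF \<open>hd p \<in> verts G\<close>] by (intro bexI[of _ v]) auto
  next
    case False
    have "set (vwalk_arcs p) \<subseteq> arcs_ends ?H"
    proof
      fix e assume e: "e \<in> set (vwalk_arcs p)"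
      then have "fst e \<noteq> v" "snd e \<noteq> v"
        using arcs_in_vwalk_arcs[OF e] False by auto
      then show "e \<in> arcs_ends ?H"
        using pv(4) e by (auto simp: arcs_ends_conv pre_digraph.del_vert_simps)
    qed
    then have "vpath p ?H"
      using pv False V by (auto simp: vpath_def vwalk_def)
    then obtain x where "x \<in> set p" "c (hd p) < c x"
      using c p ends unfolding feasible_labeling_def by auto
    then show ?thesis
      using False ends by (intro bexI[of _ x]) auto
  qed
qed

section \<open>Graphs of points on a circle\<close>

lemma rotation_closed_eq:
  fixes n :: int
  assumes "X \<subseteq> {0..<n}" "x \<in> X" "\<And>y. y \<in> X \<Longrightarrow> (y + 1) mod n \<in> X"
  shows "X = {0..<n}"
proof
  have iter: "(x + int i) mod n \<in> X" for i
  proof (induction i)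
    case 0
    then show ?case using assms(1,2) by auto
  next
    case (Suc i)
    then show ?case
      using assms(3)[OF Suc] by (simp add: mod_simps ac_simps)
  qed
  show "{0..<n} \<subseteq> X"
  proof
    fix y assume y: "y \<in> {0..<n}"
    \<comment> \<open>Adding \<open>n\<close> makes the number of unit steps from \<open>x\<close>
      to \<open>y\<close> nonnegative.\<close>
    have "(x + int (nat (y - x + n))) mod n = y"
      using y assms(1,2) by (auto simp: subset_iff)
    then show "y \<in> X" using iter by metis
  qed
qed (use assms in auto)

text \<open>\<open>X j\<close> is the sumset of \<open>Q\<close> and the interval from
  \<open>a\<close> to \<open>a + j - 1\<close> modulo \<open>n\<close>. Each further translate adds
  an element: otherwise \<open>X j\<close> would be closed under adding 1 and hence be everything.
  This is the Cauchy-Davenport bound, valid for every modulus because one summand is an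
  interval.\<close>

lemma card_cyclic_sumset_interval:
  fixes n a :: int
  assumes Q: "Q \<subseteq> {0..<n}" "Q \<noteq> {}"
    and X: "X = (\<lambda>j. \<Union>i<j. (\<lambda>q. (q + a + int i) mod n) ` Q)" and "1 \<le> k" "X k \<noteq> {0..<n}"
  shows "card Q + k \<le> card (X k) + 1"
  using \<open>1 \<le> k\<close> \<open>X k \<noteq> {0..<n}\<close>
proof (induction k rule: dec_induct)
  case base
  have "inj_on (\<lambda>q. (q + a) mod n) Q"
  proof (rule inj_onI)
    fix p q assume "p \<in> Q" "q \<in> Q" and "(p + a) mod n = (q + a) mod n"
    then have "p mod n = q mod n"
      by (metis add_diff_cancel_right' mod_diff_left_eq)
    moreover have "p \<in> {0..<n}" "q \<in> {0..<n}"
      using \<open>p \<in> Q\<close> \<open>q \<in> Q\<close> Q(1) by blast+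
    ultimately show "p = q" by simp
  qed
  then show ?case by (simp add: X card_image lessThan_Suc)
next
  case (step j)
  have "n > 0" using Q by auto
  then have sub: "X i \<subseteq> {0..<n}" for i by (auto simp: X)
  have rot: "(y + 1) mod n \<in> X (Suc i)" if y: "y \<in> X i" for y i
  proof -
    obtain r q where "r < i" "q \<in> Q" "y = (q + a + int r) mod n"
      using y by (auto simp: X)
    then show ?thesis
      by (auto simp: X mod_simps ac_simps intro!: bexI[of _ "Suc r"] image_eqI[of _ _ q])
  qed
  have mono: "X j \<subseteq> X (Suc j)" unfolding X by (rule UN_mono) auto
  have "X j \<noteq> {}"
    using Q(2) step.hyps by (auto simp: X intro!: exI[of _ 0])
  then obtain x where "x \<in> X j" by blast
  have "X j \<noteq> X (Suc j)"
    using rotation_closed_eq[OF sub \<open>x \<in> X j\<close>] rot step.prems by blast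
  then have "card (X j) < card (X (Suc j))"
    using mono sub[of "Suc j"] by (meson finite_atLeastLessThan_int finite_subset psubsetI psubset_card_mono)
  moreover have "X j \<noteq> {0..<n}"
    using \<open>X j \<noteq> X (Suc j)\<close> mono sub by blast
  ultimately show ?case using step.IH by simp
qed

text \<open>The interval from \<open>k\<close> to \<open>2 * k - 1\<close> is invariant under
  \<open>d\<close> to \<open>3 * k - 1 - d\<close>, so the sign of the difference is irrelevant
  modulo \<open>3 * k - 1\<close>. This form exhibits neighbourhoods as sumsets.\<close>

lemma far_iff_shift:
  fixes a b :: int
  assumes "0 \<le> a" "a < 3 * int k - 1" "0 \<le> b" "b < 3 * int k - 1"
  shows "\<bar>a - b\<bar> \<in> {int k..2 * int k - 1} \<longleftrightarrow> (\<exists>i<k. b = (a + int k + int i) mod (3 * int k - 1))"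
proof
  assume far: "\<bar>a - b\<bar> \<in> {int k..2 * int k - 1}"
  show "\<exists>i<k. b = (a + int k + int i) mod (3 * int k - 1)"
  proof (cases "a \<le> b")
    case True
    then show ?thesis
      using far assms by (intro exI[of _ "nat (b - a - int k)"]) auto
  next
    case False
    then have "a + int k + int (nat (b - a + 2 * int k - 1)) = b + (3 * int k - 1)"
      using far by auto
    then have "b = (a + int k + int (nat (b - a + 2 * int k - 1))) mod (3 * int k - 1)"
      using assms by (simp only: mod_add_self2) simp
    moreover have "nat (b - a + 2 * int k - 1) < k"
      using far False by auto
    ultimately show ?thesis by blast
  qed
next
  assume "\<exists>i<k. b = (a + int k + int i) mod (3 * int k - 1)"
  then obtain i where i: "i < k" "b = (a + int k + int i) mod (3 * int k - 1)" by blast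
  show "\<bar>a - b\<bar> \<in> {int k..2 * int k - 1}"
  proof (cases "a + int k + int i < 3 * int k - 1")
    case True
    then have "b = a + int k + int i" using i assms by simp
    then show ?thesis using i by auto
  next
    case False
    have "(a + int k + int i) mod (3 * int k - 1)
        = (a + int k + int i - (3 * int k - 1)) mod (3 * int k - 1)"
      by (rule minus_mod_self2[symmetric])
    also have "\<dots> = a + int k + int i - (3 * int k - 1)"
      using False i assms by (intro mod_pos_pos_trivial) auto
    finally show ?thesis using i by auto
  qed
qed

text \<open>Serves to measure adjacency on positions unrolled onto a line: \<open>e\<close> is the
  difference on the circle, \<open>d\<close> the unrolled one. One turn reflects the interval onto
  itself; two turns violate the bound on \<open>e\<close>.\<close>

lemma far_mod_turns:
  fixes d e k :: int
  assumes "\<bar>d\<bar> \<le> 2 * k - 2" "\<bar>e\<bar> \<le> 3 * k - 2"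
    "e \<in> {d, d - (3 * k - 1), d + (3 * k - 1), d - 2 * (3 * k - 1), d + 2 * (3 * k - 1)}"
  shows "\<bar>e\<bar> \<in> {k..2 * k - 1} \<longleftrightarrow> k \<le> \<bar>d\<bar>"
  using assms by (smt (verit) insert_iff empty_iff atLeastAtMost_iff)

text \<open>With \<open>n = 3 * k - 1\<close> one has \<open>n - k = 2 * k - 1\<close>, so adjacency
  means circular distance at least \<open>k\<close>: this is the circular complete graph with
  parameters \<open>n\<close> and \<open>k\<close>.\<close>

locale circular_graph = graph G for G :: "('a, 'b) pre_digraph" +
  fixes k :: nat and pos :: "'a \<Rightarrow> int"
  assumes k_ge_1: "1 \<le> k"
    and bij_pos: "bij_betw pos (verts G) {0..<3 * int k - 1}"
    and adj_iff: "u \<in> verts G \<Longrightarrow> v \<in> verts G \<Longrightarrow>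
      u \<rightarrow>\<^bsub>G\<^esub> v \<longleftrightarrow> \<bar>pos u - pos v\<bar> \<in> {int k..2 * int k - 1}"
begin

section \<open>Adjacency, triangles and domination\<close>

abbreviation adj :: "'a \<Rightarrow> 'a \<Rightarrow> bool" (infix \<open>\<frown>\<close> 50) where
  "u \<frown> v \<equiv> u \<rightarrow>\<^bsub>G\<^esub> v"

definition nbhd :: "'a set \<Rightarrow> 'a set" where
  "nbhd P = {v. \<exists>u \<in> P. u \<frown> v}"

lemma card_verts: "card (verts G) = 3 * k - 1"
  using bij_betw_same_card[OF bij_pos] by simp

lemma pos_bounds: "u \<in> verts G \<Longrightarrow> 0 \<le> pos u \<and> pos u < 3 * int k - 1"
  using bij_pos by (auto simp: bij_betw_def)

lemma pos_eqD: "u \<in> verts G \<Longrightarrow> v \<in> verts G \<Longrightarrow> pos u = pos v \<Longrightarrow> u = v"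
  using bij_pos by (auto simp: bij_betw_def inj_on_def)

lemma pos_surj: "0 \<le> i \<Longrightarrow> i < 3 * int k - 1 \<Longrightarrow> \<exists>u \<in> verts G. pos u = i"
  using bij_betw_imp_surj_on[OF bij_pos] by (metis atLeastLessThan_iff imageE)

lemma adj_sym: "u \<frown> v \<Longrightarrow> v \<frown> u"
  using adj_iff adj_in_verts by (metis abs_minus_commute)

lemma adj_irrefl: "\<not> u \<frown> u"
  using adj_iff[of u u] adj_in_verts(1)[of u u] k_ge_1 by auto

text \<open>The three circular gaps of a triangle would each be at least \<open>k\<close>, but they
  sum to \<open>3 * k - 1\<close>.\<close>

lemma triangle_free:
  assumes "u \<frown> v" "v \<frown> w" shows "\<not> u \<frown> w"
proof -
  have "u \<in> verts G" "v \<in> verts G" "w \<in> verts G"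
    using assms adj_in_verts by blast+
  then show ?thesis
    using assms unfolding adj_iff[OF \<open>u \<in> verts G\<close> \<open>v \<in> verts G\<close>]
      adj_iff[OF \<open>v \<in> verts G\<close> \<open>w \<in> verts G\<close>] adj_iff[OF \<open>u \<in> verts G\<close> \<open>w \<in> verts G\<close>]
    by (smt (verit) atLeastAtMost_iff)
qed

lemma two_edges_dominate:
  assumes "x \<frown> x'" "y \<frown> y'" "z \<in> verts G"
    and cross: "\<not> x \<frown> y" "\<not> x \<frown> y'" "\<not> x' \<frown> y" "\<not> x' \<frown> y'"
  shows "z \<frown> x \<or> z \<frown> x' \<or> z \<frown> y \<or> z \<frown> y'"
proof (rule ccontr)
  define n where "n = 3 * int k - 1"
  \<comment> \<open>Signed position relative to \<open>z\<close>; on the non-neighbours of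
    \<open>z\<close> it lies strictly between \<open>-k\<close> and \<open>k\<close>.\<close>
  define d where "d u = (if pos u - pos z \<ge> 2 * int k then pos u - pos z - n
    else if pos u - pos z \<le> - 2 * int k then pos u - pos z + n else pos u - pos z)" for u
  assume "\<not> (z \<frown> x \<or> z \<frown> x' \<or> z \<frown> y \<or> z \<frown> y')"
  then have far: "\<not> z \<frown> x" "\<not> z \<frown> x'" "\<not> z \<frown> y" "\<not> z \<frown> y'" by auto
  have V: "x \<in> verts G" "x' \<in> verts G" "y \<in> verts G" "y' \<in> verts G"
    using assms adj_in_verts by blast+
  have near: "\<bar>d u\<bar> < int k" if "u \<in> verts G" "\<not> z \<frown> u" for u
    using that(2) pos_bounds[OF that(1)] pos_bounds[OF assms(3)]
    unfolding adj_iff[OF assms(3) that(1)] d_def n_def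
    by (smt (verit) atLeastAtMost_iff)
  have adj_d: "u \<frown> v \<longleftrightarrow> \<bar>d u - d v\<bar> \<ge> int k"
    if "u \<in> verts G" "v \<in> verts G" "\<not> z \<frown> u" "\<not> z \<frown> v" for u v
  proof -
    have "\<bar>d u - d v\<bar> \<le> 2 * int k - 2"
      using near[of u] near[of v] that by linarith
    moreover have "\<bar>pos u - pos v\<bar> \<le> 3 * int k - 2"
      using pos_bounds[of u] pos_bounds[of v] that by linarith
    moreover have "pos u - pos v \<in> {d u - d v, d u - d v - n, d u - d v + n,
        d u - d v - 2 * n, d u - d v + 2 * n}"
      by (simp add: d_def)
    ultimately show ?thesis
      unfolding adj_iff[OF that(1,2)] n_def by (rule far_mod_turns)
  qed
  \<comment> \<open>On the line, order the edges so that \<open>d x < d x'\<close> and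
    \<open>d y < d y'\<close>. Then \<open>(d x' - d y) + (d y' - d x)\<close> is the sum of the two
    edge lengths, at least \<open>2 * k\<close>, so one summand is at least \<open>k\<close> and
    gives a forbidden cross edge.\<close>
  show False
    using assms(1,2) cross near[OF V(1) far(1)] near[OF V(2) far(2)] near[OF V(3) far(3)]
      near[OF V(4) far(4)]
    unfolding adj_d[OF V(1,2) far(1,2)] adj_d[OF V(3,4) far(3,4)]
      adj_d[OF V(1,3) far(1,3)] adj_d[OF V(1,4) far(1,4)]
      adj_d[OF V(2,3) far(2,3)] adj_d[OF V(2,4) far(2,4)]
    by (smt (verit))
qed

section \<open>Sizes of neighbourhoods and independent sets\<close>

lemma card_nbhd:
  assumes P: "P \<subseteq> verts G" "P \<noteq> {}" "nbhd P \<noteq> verts G"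
  shows "card P + k \<le> card (nbhd P) + 1"
proof -
  define n where "n = 3 * int k - 1"
  define X where "X = (\<lambda>j. \<Union>i<j. (\<lambda>q. (q + int k + int i) mod n) ` (pos ` P))"
  have nV: "nbhd P \<subseteq> verts G"
    using adj_in_verts by (auto simp: nbhd_def)
  have inj: "inj_on pos (verts G)" and img: "pos ` verts G = {0..<n}"
    using bij_pos by (auto simp: bij_betw_def n_def)
  have "n > 0" using k_ge_1 by (simp add: n_def)
  have mem: "u \<frown> v \<longleftrightarrow> (\<exists>i<k. pos v = (pos u + int k + int i) mod n)"
    if "u \<in> verts G" "v \<in> verts G" for u v
    unfolding adj_iff[OF that] n_def
    using far_iff_shift[of "pos u" k "pos v"] pos_bounds that by blast
  \<comment> \<open>The neighbourhood is the sumset of the positions of \<open>P\<close> and the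
    interval of \<open>k\<close> residues from \<open>k\<close> to \<open>2 * k - 1\<close>.\<close>
  have "pos ` nbhd P = X k"
  proof
    show "pos ` nbhd P \<subseteq> X k"
    proof
      fix b assume "b \<in> pos ` nbhd P"
      then obtain u v where "u \<in> P" "u \<frown> v" "b = pos v"
        by (auto simp: nbhd_def)
      moreover from this obtain i where "i < k" "pos v = (pos u + int k + int i) mod n"
        using mem[of u v] P(1) adj_in_verts(2) by blast
      ultimately show "b \<in> X k" by (auto simp: X_def)
    qed
    show "X k \<subseteq> pos ` nbhd P"
    proof
      fix b assume "b \<in> X k"
      then obtain u i where ui: "u \<in> P" "i < k" "b = (pos u + int k + int i) mod n"
        by (auto simp: X_def)
      then have "b \<in> pos ` verts G" unfolding img using \<open>n > 0\<close> by simp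
      then obtain v where "v \<in> verts G" "pos v = b" by (elim imageE) simp
      then show "b \<in> pos ` nbhd P"
        using mem[of u v] ui P(1) unfolding nbhd_def by blast
    qed
  qed
  moreover have "X k \<noteq> {0..<n}"
    using P(3) nV inj img calculation by (metis inj_on_image_eq_iff order_refl)
  moreover have "pos ` P \<subseteq> {0..<n}" "pos ` P \<noteq> {}"
    using P img by auto
  ultimately have "card (pos ` P) + k \<le> card (pos ` nbhd P) + 1"
    using card_cyclic_sumset_interval[of "pos ` P" n X "int k" k] X_def k_ge_1 by simp
  then show ?thesis
    using inj P(1) nV by (simp add: card_image inj_on_subset)
qed

lemma card_nbhd_single: "u \<in> verts G \<Longrightarrow> k \<le> card (nbhd {u})"
  using card_nbhd[of "{u}"] adj_irrefl by (force simp: nbhd_def)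

text \<open>An independent \<open>P\<close> is disjoint from its neighbourhood, which has at least
  \<open>card P + k - 1\<close> vertices, and both fit into \<open>3 * k - 1\<close>
  vertices.\<close>

lemma card_independent:
  assumes "P \<subseteq> verts G" and indep: "\<And>u v. u \<in> P \<Longrightarrow> v \<in> P \<Longrightarrow> \<not> u \<frown> v"
  shows "card P \<le> k"
proof (cases "P = {}")
  case False
  have disj: "P \<inter> nbhd P = {}" using indep by (auto simp: nbhd_def)
  have nV: "nbhd P \<subseteq> verts G" using adj_in_verts by (auto simp: nbhd_def)
  have "card P + k \<le> card (nbhd P) + 1"
    using card_nbhd assms(1) False disj by blast
  moreover have "card P + card (nbhd P) = card (P \<union> nbhd P)"
    using disj nV assms(1) by (intro card_Un_disjoint[symmetric]) (auto intro: finite_subset)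
  moreover have "\<dots> \<le> card (verts G)"
    using nV assms(1) by (intro card_mono) auto
  ultimately show ?thesis using card_verts by simp
qed simp

section \<open>Lower bound for the number of labels\<close>

lemma feasible_labeling_max_label:
  assumes c: "feasible_labeling G c" and m: "c ` verts G \<subseteq> {1..m}"
  shows "2 * k \<le> m"
proof -
  define J where "J = {u \<in> verts G. \<exists>v. u \<frown> v \<and> c v \<le> c u}"
  have J_V: "J \<subseteq> verts G" and finJ: "finite J"
    by (auto simp: J_def)
  have less: "c v < c u" if "u \<frown> v" "c v \<le> c u" for u v
    using feasible_labeling_adj_neq[OF c wf_digraph_axioms that(1)] that adj_irrefl by fastforce
  have range: "1 \<le> c u" "c u \<le> m" if "u \<in> verts G" for u
    using m that by auto
  have "card (verts G - J) \<le> k"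
  proof (rule card_independent)
    fix u v assume "u \<in> verts G - J" "v \<in> verts G - J"
    then show "\<not> u \<frown> v"
      using adj_sym[of u v] by (auto simp: J_def) (metis nle_le)
  qed simp
  moreover have "card (verts G - J) = card (verts G) - card J"
    using J_V finJ by (simp add: card_Diff_subset)
  ultimately have cardJ: "2 * k \<le> card J + 1"
    using card_verts by simp
  show ?thesis
  proof (cases "inj_on c J")
    case True
    \<comment> \<open>A vertex of \<open>J\<close> has a neighbour of smaller, still positive label.
      So \<open>m - 1\<close> labels are available for at least \<open>2 * k - 1\<close>
      vertices.\<close>
    have "c ` J \<subseteq> {2..m}"
    proof
      fix i assume "i \<in> c ` J"
      then obtain u v where "u \<in> verts G" "u \<frown> v" "c v < c u" "i = c u"
        using less by (auto simp: J_def)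
      then show "i \<in> {2..m}"
        using range[of u] range(1)[of v] adj_in_verts(2) by fastforce
    qed
    then have "card J \<le> card {2..m}"
      by (metis True card_image card_mono finite_atLeastAtMost)
    then show ?thesis using cardJ k_ge_1 by simp
  next
    case False
    define T where "T = {t. \<exists>x \<in> J. \<exists>y \<in> J. x \<noteq> y \<and> c x = t \<and> c y = t}"
    have "finite T"
      by (rule finite_subset[of _ "c ` J"]) (auto simp: T_def finJ)
    moreover have "T \<noteq> {}"
      using False by (auto simp: T_def inj_on_def)
    define t where "t = Max T"
    ultimately have "t \<in> T" and t_max: "\<And>s. s \<in> T \<Longrightarrow> s \<le> t"
      using \<open>T \<noteq> {}\<close> by (auto simp: t_def)
    then obtain x y where xy: "x \<in> J" "y \<in> J" "x \<noteq> y" "c x = t" "c y = t"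
      by (auto simp: T_def)
    obtain x' where x': "x \<frown> x'" "c x' < t"
      using less xy(1,4) unfolding J_def by blast
    obtain y' where y': "y \<frown> y'" "c y' < t"
      using less xy(2,5) unfolding J_def by blast
    have V: "x \<in> verts G" "y \<in> verts G" "x' \<in> verts G" "y' \<in> verts G"
      using xy J_V x' y' adj_in_verts by blast+
    define W where "W = {u \<in> verts G. c u \<le> t}"
    define S where "S = verts G - W"
    define R where "R = (low_arcs G c t)\<^sup>*"
    have step: "(u, v) \<in> R" if "u \<frown> v" "u \<in> W" "v \<in> W" for u v
      using that by (auto simp: R_def low_arcs_def W_def)
    have Rtrans: "(u, w) \<in> R" if "(u, v) \<in> R" "(v, w) \<in> R" for u v w
      using that by (simp add: R_def)
    have Rsym: "(v, u) \<in> R" if "(u, v) \<in> R" for u v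
    proof -
      have "sym (low_arcs G c t)"
        using adj_sym by (auto simp: low_arcs_def sym_def)
      then show ?thesis
        using that unfolding R_def by (metis sym_rtrancl symD)
    qed
    have sep: "(x, y) \<notin> R"
      using feasible_labeling_connected_eq[OF c V(1) _ _ wf_digraph_axioms, of y] xy
      by (auto simp: R_def)
    have W: "x \<in> W" "x' \<in> W" "y \<in> W" "y' \<in> W"
      using V xy x' y' by (auto simp: W_def)
    have Rx: "(x, x') \<in> R" "(y, y') \<in> R"
      using step x' y' W by blast+
    \<comment> \<open>An edge inside \<open>W\<close> between the components of \<open>x\<close> and
      \<open>y\<close> would join these two distinct vertices of label \<open>t\<close> below
      \<open>t\<close>.\<close>
    have across: "\<not> u \<frown> v" if "(x, u) \<in> R" "(y, v) \<in> R" "u \<in> W" "v \<in> W" for u v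
      using that step Rtrans Rsym sep by blast
    have refl: "(u, u) \<in> R" for u by (simp add: R_def)
    have cross: "\<not> x \<frown> y" "\<not> x \<frown> y'" "\<not> x' \<frown> y" "\<not> x' \<frown> y'"
      using across Rx refl W by blast+
    \<comment> \<open>By domination every vertex of \<open>S\<close> has a neighbour among
      \<open>x\<close>, \<open>x'\<close>, \<open>y\<close>, \<open>y'\<close>, hence one of smaller
      label, so it lies in \<open>J\<close>; a repeated label above \<open>t\<close> then
      contradicts the maximality of \<open>t\<close>.\<close>
    have S_inj: "inj_on c S"
    proof (rule inj_onI, rule ccontr)
      fix u v assume uv: "u \<in> S" "v \<in> S" "c u = c v" "u \<noteq> v"
      then have "c u > t" by (auto simp: S_def W_def)
      have "u \<in> J" if "u \<in> S" "c u > t" for u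
      proof -
        have "u \<in> verts G" using that by (simp add: S_def)
        with two_edges_dominate[OF x'(1) y'(1) _ cross]
        obtain z where "u \<frown> z" "z \<in> {x, x', y, y'}" by blast
        then show ?thesis
          using that xy x' y' \<open>u \<in> verts G\<close> by (auto simp: J_def intro!: exI[of _ z])
      qed
      then have "u \<in> J" "v \<in> J"
        using uv \<open>c u > t\<close> by simp_all
      then have "c u \<in> T"
        unfolding T_def using uv(3,4) by auto
      then show False using t_max \<open>c u > t\<close> by fastforce
    qed
    have "c ` S \<subseteq> {t<..m}"
      using range by (auto simp: S_def W_def)
    then have "card S \<le> m - t"
      by (metis S_inj card_image card_mono finite_greaterThanAtMost card_greaterThanAtMost)
    \<comment> \<open>\<open>A\<close> and \<open>B\<close> are the parts of the component of the edge \<open>x x'\<close> below \<open>t\<close>.\<close>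
    define A where "A = {u \<in> W. u \<frown> x'}"
    define B where "B = {u \<in> W. u \<frown> x}"
    have AR: "(x, u) \<in> R" if "u \<in> A \<union> B" for u
      using that step[of x u] step[of x' u] Rtrans[OF Rx(1)] W adj_sym by (auto simp: A_def B_def)
    have nonadj_y: "\<not> u \<frown> y" "\<not> u \<frown> y'" if "u \<in> A \<union> B" for u
      using across[OF AR[OF that]] that refl Rx W by (auto simp: A_def B_def)
    \<comment> \<open>The edges \<open>u x'\<close> and \<open>y y'\<close> also dominate. Of their
      ends, \<open>v\<close> misses \<open>x'\<close> by triangle-freeness and \<open>y\<close>,
      \<open>y'\<close> by separation, so only \<open>u\<close> remains.\<close>
    have complete: "u \<frown> v" if "u \<in> A" "v \<in> B" for u v
    proof -
      have "u \<frown> x'" "v \<frown> x" using that by (auto simp: A_def B_def)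
      moreover have "\<not> v \<frown> x'"
        using triangle_free \<open>v \<frown> x\<close> x'(1) by blast
      ultimately have "v \<frown> u"
        using two_edges_dominate[of u x' y y' v] y'(1) cross nonadj_y[of u] nonadj_y[of v] that
          adj_in_verts(1) by blast
      then show ?thesis by (rule adj_sym)
    qed
    \<comment> \<open>Such a \<open>v\<close> is separated from \<open>y\<close> and
      \<open>y'\<close>, so domination forces it to be adjacent to \<open>x\<close> or
      \<open>x'\<close>.\<close>
    have closed: "v \<in> A \<union> B" if "u \<in> A \<union> B" "u \<frown> v" "v \<in> W" for u v
    proof -
      have "(x, v) \<in> R"
        using Rtrans[OF AR step] that by (auto simp: A_def B_def)
      then have "\<not> v \<frown> y" "\<not> v \<frown> y'"
        using across that(3) W refl Rx by blast+
      then show ?thesis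
        using two_edges_dominate[OF x'(1) y'(1) _ cross, of v] that(3)
        by (auto simp: A_def B_def W_def)
    qed
    have nA: "nbhd A \<subseteq> B \<union> (nbhd A \<inter> S)"
    proof
      fix v assume v: "v \<in> nbhd A"
      then obtain u where u: "u \<in> A" "u \<frown> v" by (auto simp: nbhd_def)
      have "v \<notin> A"
        using u triangle_free[of u v x'] by (auto simp: A_def)
      then show "v \<in> B \<union> (nbhd A \<inter> S)"
        using closed[of u v] u v adj_in_verts(2) by (auto simp: S_def)
    qed
    have nB: "nbhd B \<subseteq> A \<union> (nbhd B \<inter> S)"
    proof
      fix v assume v: "v \<in> nbhd B"
      then obtain u where u: "u \<in> B" "u \<frown> v" by (auto simp: nbhd_def)
      have "v \<notin> B"
        using u triangle_free[of u v x] by (auto simp: B_def)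
      then show "v \<in> A \<union> (nbhd B \<inter> S)"
        using closed[of u v] u v adj_in_verts(2) by (auto simp: S_def)
    qed
    have fin: "finite A" "finite B" "finite S"
      by (auto simp: A_def B_def W_def S_def)
    have "x \<in> A" "x' \<in> B"
      using W x'(1) adj_sym by (auto simp: A_def B_def)
    \<comment> \<open>This supplies the condition of \<open>card_nbhd\<close> that the neighbourhood
      is not the whole vertex set.\<close>
    have "x \<notin> nbhd A" "x' \<notin> nbhd B"
      using triangle_free[OF _ x'(1)] by (auto simp: A_def B_def nbhd_def)
    then have "card A + k \<le> card (nbhd A) + 1" "card B + k \<le> card (nbhd B) + 1"
      using card_nbhd[of A] card_nbhd[of B] \<open>x \<in> A\<close> \<open>x' \<in> B\<close> V by (auto simp: A_def B_def W_def)
    moreover have "card (nbhd A) \<le> card B + card (nbhd A \<inter> S)"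
      using card_mono[OF _ nA] card_Un_le[of B "nbhd A \<inter> S"] fin by fastforce
    moreover have "card (nbhd B) \<le> card A + card (nbhd B \<inter> S)"
      using card_mono[OF _ nB] card_Un_le[of A "nbhd B \<inter> S"] fin by fastforce
    \<comment> \<open>A common neighbour would close a triangle with an edge between
      \<open>A\<close> and \<open>B\<close>.\<close>
    moreover have "nbhd A \<inter> nbhd B = {}"
      using complete triangle_free unfolding nbhd_def by blast
    then have "card (nbhd A \<inter> S) + card (nbhd B \<inter> S) = card ((nbhd A \<inter> S) \<union> (nbhd B \<inter> S))"
      using fin by (intro card_Un_disjoint[symmetric]) auto
    moreover have "\<dots> \<le> card S"
      using fin by (intro card_mono) auto
    ultimately have "2 * k \<le> card S + 2" by linarith
    \<comment> \<open>The label of \<open>x'\<close> is positive and below \<open>t\<close>;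
      \<open>t \<le> m\<close> keeps \<open>m - t\<close> from being truncated.\<close>
    moreover have "2 \<le> t" "t \<le> m"
      using x'(2) range[of x'] V range[of x] xy by auto
    ultimately show ?thesis using \<open>card S \<le> m - t\<close> by linarith
  qed
qed

lemma tree_depth_ge: "2 * k \<le> tree_depth G"
  using tree_depth_attained feasible_labeling_max_label by blast

lemma tree_depth_del_vert_ge: "2 * k \<le> Suc (tree_depth (del_vert v))"
proof -
  interpret H: fin_digraph "del_vert v" by (rule fin_digraph_del_vert)
  obtain c where c: "feasible_labeling (del_vert v) c"
    "c ` verts (del_vert v) \<subseteq> {1..tree_depth (del_vert v)}"
    using H.tree_depth_attained by blast
  have "(c(v := Suc (tree_depth (del_vert v)))) ` verts G \<subseteq> {1..Suc (tree_depth (del_vert v))}"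
    using c(2) by (fastforce simp: pre_digraph.verts_del_vert)
  then show ?thesis
    using feasible_labeling_max_label feasible_labeling_del_vert[OF c] by blast
qed

section \<open>Choosing the class of label 2\<close>

lemma almost_antipodal:
  assumes w: "w \<in> verts G"
  obtains z z' where "z \<in> verts G" "z' \<in> verts G" "\<not> z \<frown> w" "\<not> z' \<frown> w"
    "\<And>u v. z \<frown> u \<Longrightarrow> z \<frown> v \<Longrightarrow> u \<frown> w \<Longrightarrow> v \<frown> w \<Longrightarrow> u = v"
    "\<And>u v. z' \<frown> u \<Longrightarrow> z' \<frown> v \<Longrightarrow> u \<frown> w \<Longrightarrow> v \<frown> w \<Longrightarrow> u = v"
    "\<And>v. k \<ge> 2 \<Longrightarrow> z \<frown> v \<Longrightarrow> \<not> z' \<frown> v"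
proof -
  \<comment> \<open>These are \<open>pos w - (k - 1)\<close> and \<open>pos w + (k - 1)\<close>
    modulo \<open>3 * k - 1\<close>. Relative to \<open>w\<close>, the neighbours of
    \<open>z\<close> occupy the offsets \<open>1\<close> to \<open>k\<close>, those of
    \<open>z'\<close> the offsets \<open>2 * k - 1\<close> to \<open>3 * k - 2\<close>, and those of
    \<open>w\<close> the offsets \<open>k\<close> to \<open>2 * k - 1\<close>. The first two ranges
    each meet the third in one offset, and are disjoint once \<open>k < 2 * k - 1\<close>.\<close>
  let ?i = "if pos w < int k - 1 then pos w + 2 * int k else pos w - (int k - 1)"
  let ?j = "if pos w < 2 * int k then pos w + (int k - 1) else pos w - 2 * int k"
  have "\<exists>u \<in> verts G. pos u = ?i"
    by (rule pos_surj) (use pos_bounds[OF w] k_ge_1 in auto)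
  then obtain z where z: "z \<in> verts G" "pos z = ?i" by blast
  have "\<exists>u \<in> verts G. pos u = ?j"
    by (rule pos_surj) (use pos_bounds[OF w] k_ge_1 in auto)
  then obtain z' where z': "z' \<in> verts G" "pos z' = ?j" by blast
  have far: "\<bar>pos u - pos v\<bar> \<in> {int k..2 * int k - 1}" "u \<in> verts G" "v \<in> verts G"
    if "u \<frown> v" for u v
    using that adj_iff adj_in_verts by blast+
  show thesis
  proof
    show "z \<in> verts G" "z' \<in> verts G" by fact+
    show "\<not> z \<frown> w" "\<not> z' \<frown> w"
      using z z' w by (auto simp: adj_iff)
    show "u = v" if "z \<frown> u" "z \<frown> v" "u \<frown> w" "v \<frown> w" for u v
      using far[OF that(1)] far[OF that(2)] far[OF that(3)] far[OF that(4)] z(2)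
        pos_bounds[of u] pos_bounds[of v] pos_bounds[OF w]
      by (intro pos_eqD) (smt (verit) atLeastAtMost_iff)+
    show "u = v" if "z' \<frown> u" "z' \<frown> v" "u \<frown> w" "v \<frown> w" for u v
      using far[OF that(1)] far[OF that(2)] far[OF that(3)] far[OF that(4)] z'(2)
        pos_bounds[of u] pos_bounds[of v] pos_bounds[OF w]
      by (intro pos_eqD) (smt (verit) atLeastAtMost_iff)+
    show "\<not> z' \<frown> v" if "k \<ge> 2" "z \<frown> v" for v
    proof
      assume "z' \<frown> v"
      have "int k \<ge> 2" using that(1) by simp
      then show False
        using far(1)[OF that(2)] far(1)[OF \<open>z' \<frown> v\<close>] z(2) z'(2)
          pos_bounds[OF far(3)[OF that(2)]] pos_bounds[OF w]
        by (simp only: atLeastAtMost_iff) (smt (verit))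
    qed
  qed
qed

lemma one_unique: "one_unique G"
  unfolding one_unique_def
proof
  fix w assume w: "w \<in> verts G"
  obtain z where z: "z \<in> verts G" "\<not> z \<frown> w"
    "\<And>u v. z \<frown> u \<Longrightarrow> z \<frown> v \<Longrightarrow> u \<frown> w \<Longrightarrow> v \<frown> w \<Longrightarrow> u = v"
    using almost_antipodal[OF w] by metis
  show "\<exists>c. feasible_labeling G c \<and> c ` verts G \<subseteq> {1..tree_depth G} \<and> {u \<in> verts G. c u = 1} = {w}"
  proof (rule feasible_labeling_unique_1[of "nbhd {z}"])
    show "nbhd {z} \<subseteq> verts G" "w \<notin> nbhd {z}"
      using z adj_in_verts by (auto simp: nbhd_def)
    show "\<not> u \<frown> v" if "u \<in> nbhd {z}" "v \<in> nbhd {z}" for u v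
      using that triangle_free by (auto simp: nbhd_def)
    show "u = v" if "u \<in> nbhd {z}" "v \<in> nbhd {z}" "u \<frown> w" "w \<frown> v" for u v
      using that z(3) adj_sym by (auto simp: nbhd_def)
    \<comment> \<open>At most \<open>(3 * k - 1) - k = 2 * k - 1\<close> vertices lie outside the
      neighbourhood.\<close>
    show "card (verts G) - card (nbhd {z}) < tree_depth G" "2 \<le> tree_depth G"
      using card_nbhd_single[OF z(1)] tree_depth_ge card_verts k_ge_1 by linarith+
  qed fact
qed

lemma one_unique_del_vert:
  assumes "v \<in> verts G"
  shows "one_unique (del_vert v)"
  unfolding one_unique_def
proof
  interpret H: graph "del_vert v" by (rule graph_del_vert)
  have VH: "verts (del_vert v) = verts G - {v}" by (simp add: pre_digraph.verts_del_vert)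
  have cardH: "card (verts (del_vert v)) = 3 * k - 2"
    using assms card_verts by (simp add: VH)
  have adjH: "a \<frown> b" if "a \<rightarrow>\<^bsub>del_vert v\<^esub> b" for a b
    using that by (auto simp: arcs_ends_conv pre_digraph.del_vert_simps)
  fix w assume wH: "w \<in> verts (del_vert v)"
  then have w: "w \<in> verts G" by (simp add: VH)
  show "\<exists>c. feasible_labeling (del_vert v) c \<and>
      c ` verts (del_vert v) \<subseteq> {1..tree_depth (del_vert v)} \<and>
      {u \<in> verts (del_vert v). c u = 1} = {w}"
  proof (cases "k \<ge> 2")
    case True
    \<comment> \<open>The two candidate neighbourhoods are disjoint, so one of them avoids
      \<open>v\<close> and survives the deletion intact.\<close>
    obtain z where z: "z \<in> verts G" "\<not> z \<frown> w" "\<not> z \<frown> v"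
      "\<And>u v. z \<frown> u \<Longrightarrow> z \<frown> v \<Longrightarrow> u \<frown> w \<Longrightarrow> v \<frown> w \<Longrightarrow> u = v"
      using almost_antipodal[OF w] True by metis
    show ?thesis
    proof (rule H.feasible_labeling_unique_1[of "nbhd {z}"])
      show "nbhd {z} \<subseteq> verts (del_vert v)" "w \<notin> nbhd {z}"
        using z adj_in_verts by (auto simp: nbhd_def VH)
      show "\<not> a \<rightarrow>\<^bsub>del_vert v\<^esub> b" if "a \<in> nbhd {z}" "b \<in> nbhd {z}" for a b
        using that triangle_free adjH by (auto simp: nbhd_def)
      show "a = b" if "a \<in> nbhd {z}" "b \<in> nbhd {z}"
        "a \<rightarrow>\<^bsub>del_vert v\<^esub> w" "w \<rightarrow>\<^bsub>del_vert v\<^esub> b" for a b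
        using that z(4) adj_sym adjH by (auto simp: nbhd_def)
      \<comment> \<open>The deletion lowers both sides by one: at most \<open>2 * k - 2\<close>
        vertices against a tree-depth of at least \<open>2 * k - 1\<close>.\<close>
      show "card (verts (del_vert v)) - card (nbhd {z}) < tree_depth (del_vert v)"
        "2 \<le> tree_depth (del_vert v)"
        using card_nbhd_single[OF z(1)] tree_depth_del_vert_ge[of v] cardH True by linarith+
    qed fact
  next
    case False
    \<comment> \<open>For \<open>k = 1\<close> the graph is a single edge, and one vertex
      remains.\<close>
    then have "card (verts (del_vert v)) = 1" using cardH k_ge_1 by simp
    then have single: "verts (del_vert v) = {w}"
      using wH by (metis card_1_singletonE singletonD)
    have td: "1 \<le> tree_depth (del_vert v)"
      using tree_depth_del_vert_ge[of v] k_ge_1 by linarith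
    have "hd p = last p" if "vpath p (del_vert v)" for p
    proof -
      have "p \<noteq> []" "set p \<subseteq> {w}" using that single by (auto simp: vpath_def vwalk_def)
      then show ?thesis by (metis hd_in_set last_in_set singletonD subsetD)
    qed
    then have "feasible_labeling (del_vert v) (\<lambda>_. 1)"
      by (auto simp: feasible_labeling_def)
    then show ?thesis
      using single td by (intro exI[of _ "\<lambda>_. 1"]) auto
  qed
qed

end

section \<open>Andrasfai graphs\<close>

text \<open>Write \<open>i - j = 3 * q + r\<close>. As \<open>3 * k\<close> is 1 modulo
  \<open>n\<close>, multiplying by \<open>k\<close> gives the residue \<open>q + k * r\<close>. The
  range of \<open>i - j\<close> places it below \<open>k\<close>, between \<open>k\<close> and
  \<open>2 * k - 1\<close>, or from \<open>2 * k\<close> on, according to \<open>r\<close>.\<close>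

lemma circular_position:
  fixes i j k :: nat
  assumes "1 \<le> k" "j < i" "i \<le> 3 * k - 2"
  defines "p \<equiv> \<lambda>u. (int k * int u) mod (3 * int k - 1)"
  shows "(i - j) mod 3 = 1 \<longleftrightarrow> \<bar>p i - p j\<bar> \<in> {int k..2 * int k - 1}"
proof -
  define n where "n = 3 * int k - 1"
  define q where "q = (i - j) div 3"
  define r where "r = (i - j) mod 3"
  have n: "n > 0" using assms(1) by (simp add: n_def)
  have ij: "i - j = 3 * q + r" "r < 3" by (simp_all add: q_def r_def)
  then have qr: "3 * int q + int r \<le> 3 * int k - 2"
    using assms(1-3) by linarith
  have bounds: "0 \<le> p i" "p i < n" "0 \<le> p j" "p j < n"
    using n by (auto simp: p_def n_def)
  have "(p i - p j) mod n = (int k * int i - int k * int j) mod n"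
    by (simp add: p_def n_def mod_diff_eq)
  also have "int k * int i - int k * int j = int k * (3 * int q + int r)"
  proof -
    have "int i - int j = 3 * int q + int r"
      using ij(1) assms(2) by linarith
    then show ?thesis by (metis right_diff_distrib)
  qed
  also have "\<dots> = (int q + int k * int r) + int q * n"
    by (simp add: n_def algebra_simps)
  also have "\<dots> mod n = (int q + int k * int r) mod n" by simp
  also have "\<dots> = int q + int k * int r"
  proof (rule mod_pos_pos_trivial)
    have "r = 0 \<or> r = 1 \<or> r = 2" using ij(2) by linarith
    then show "int q + int k * int r < n"
      using qr assms(1) by (auto simp: n_def)
  qed simp
  finally have D: "(p i - p j) mod n = int q + int k * int r" .
  have "p i - p j = int q + int k * int r \<or> p i - p j = int q + int k * int r - n"
  proof (cases "p j \<le> p i")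
    case True
    then show ?thesis using D bounds by simp
  next
    case False
    have "(p i - p j) mod n = (p i - p j + n) mod n" by simp
    also have "\<dots> = p i - p j + n"
      using False bounds by (intro mod_pos_pos_trivial) auto
    finally show ?thesis using D by simp
  qed
  moreover have "r = 0 \<or> r = 1 \<or> r = 2" using ij(2) by linarith
  ultimately show ?thesis
    unfolding r_def[symmetric] using qr assms(1) by (auto simp: n_def)
qed

lemma circular_graph_andrasfai:
  assumes "1 \<le> k"
  shows "circular_graph (andrasfai k) k (\<lambda>u. (int k * int u) mod (3 * int k - 1))"
proof -
  interpret graph "andrasfai k" by (rule graph_andrasfai)
  let ?p = "\<lambda>u. (int k * int u) mod (3 * int k - 1)"
  \<comment> \<open>Multiplication by 3 inverts multiplication by \<open>k\<close>.\<close>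
  let ?q = "\<lambda>a. nat ((3 * a) mod (3 * int k - 1))"
  have V: "verts (andrasfai k) = {0..3 * k - 2}" by (simp add: andrasfai_def)
  have n: "3 * int k - 1 > 0" using assms by simp
  have "3 * int k mod (3 * int k - 1) = 1"
    using mod_add_self2[of 1 "3 * int k - 1"] mod_pos_pos_trivial[of 1 "3 * int k - 1"] assms by simp
  then have "3 * (int k * a) mod (3 * int k - 1) = a mod (3 * int k - 1)" for a
    using mod_mult_left_eq[of "3 * int k" "3 * int k - 1" a] by (simp add: mult.assoc)
  then have inv: "3 * (int k * a mod (3 * int k - 1)) mod (3 * int k - 1) = a mod (3 * int k - 1)"
    "int k * (3 * a mod (3 * int k - 1)) mod (3 * int k - 1) = a mod (3 * int k - 1)" for a
    by (simp_all add: mod_mult_right_eq ac_simps)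
  have "bij_betw ?p {0..3 * k - 2} {0..<3 * int k - 1}"
  proof (rule bij_betw_byWitness[of _ ?q])
    show "\<forall>u \<in> {0..3 * k - 2}. ?q (?p u) = u"
      using assms by (auto simp: inv)
    show "\<forall>a \<in> {0..<3 * int k - 1}. ?p (?q a) = a"
      using n by (auto simp: inv)
    show "?p ` {0..3 * k - 2} \<subseteq> {0..<3 * int k - 1}"
      using n by auto
    show "?q ` {0..<3 * int k - 1} \<subseteq> {0..3 * k - 2}"
    proof
      fix u assume "u \<in> ?q ` {0..<3 * int k - 1}"
      then obtain a where "u = ?q a" by blast
      then show "u \<in> {0..3 * k - 2}"
        using pos_mod_bound[OF n, of "3 * a"] by auto
    qed
  qed
  moreover have "u \<rightarrow>\<^bsub>andrasfai k\<^esub> v \<longleftrightarrow> \<bar>?p u - ?p v\<bar> \<in> {int k..2 * int k - 1}"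
    if "u \<in> {0..3 * k - 2}" "v \<in> {0..3 * k - 2}" for u v
  proof -
    have "u \<rightarrow>\<^bsub>andrasfai k\<^esub> v \<longleftrightarrow> v < u \<and> (u - v) mod 3 = 1 \<or> u < v \<and> (v - u) mod 3 = 1"
      using that by (auto simp: andrasfai_def)
    also have "\<dots> \<longleftrightarrow> \<bar>?p u - ?p v\<bar> \<in> {int k..2 * int k - 1}"
      using circular_position[OF assms, of u v] circular_position[OF assms, of v u] that assms
      by (cases u v rule: linorder_cases) (auto simp: abs_minus_commute)
    finally show ?thesis .
  qed
  ultimately show ?thesis
    using assms by unfold_locales (simp_all add: V)
qed

theorem theorem4p4:
  fixes k v :: nat
  assumes "k \<ge> 1" and "v \<in> verts (andrasfai k)"
  shows "one_unique (andrasfai k) \<and> one_unique (pre_digraph.del_vert (andrasfai k) v)"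
proof -
  interpret circular_graph "andrasfai k" k "\<lambda>u. (int k * int u) mod (3 * int k - 1)"
    using assms(1) by (rule circular_graph_andrasfai)
  show ?thesis
    using one_unique one_unique_del_vert assms(2) by blast
qed

end
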